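(* Let $0<q<1$, $l>0$ and $\psi\in\mathbb R$. Let $I_4^{(\psi)}$ be the closure in $\mathcal H_l$ of the symmetric operator defined on the linear span of the basis $f^l_n$, $n\ge0$, by $$I_4^{(\psi)}=q^{-J_0/4}\bigl(e^{\mathrm i\psi}J_++e^{-\mathrm i\psi}J_-\bigr)q^{-J_0/4}.$$ Then $I_4^{(\psi)}$ is not selfadjoint and has deficiency indices $(1,1)$.
   Context: Notation: $(a;q)_n=\prod_{r=0}^{n-1}(1-aq^r)$, $[c]_q=\frac{q^{c/2}-q^{-c/2}}{q^{1/2}-q^{-1/2}}$. Discrete series representation $T_l^+$ of $U_q(\mathrm{su}_{1,1})$ ($l>0$): $\mathcal H_l$ is the Hilbert space with orthonormal basis the monomials $f^l_n(x;q)=c^l_n(q)x^n$, $n=0,1,2,\dots$, where $c^l_n(q)=q^{(1-2l)n/4}\left(\frac{(q^{2l};q)_n}{(q;q)_n}\right)^{1/2}$. The operators act by $J_0f^l_n=(l+n)f^l_n$, $J_+f^l_n=\sqrt{[2l+n]_q[n+1]_q}\,f^l_{n+1}$, $J_-f^l_n=\sqrt{[2l+n-1]_q[n]_q}\,f^l_{n-1}$, and $q^{cJ_0}f^l_n=q^{c(l+n)}f^l_n$. *)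

theory Defs
  imports
    "HOL-Analysis.Analysis"
    "HOL-Computational_Algebra.Formal_Power_Series"
    "HOL-Library.Extended_Nat"
begin

definition qpoch :: "real \<Rightarrow> real \<Rightarrow> nat \<Rightarrow> real" where
  "qpoch a q n = (\<Prod>r<n. 1 - a * q ^ r)"

definition qbracket :: "real \<Rightarrow> real \<Rightarrow> real" where
  "qbracket q c =
     (q powr (c / 2) - q powr (- c / 2)) / (q powr (1 / 2) - q powr (- 1 / 2))"


definition cscale :: "complex \<Rightarrow> complex fps \<Rightarrow> complex fps" where
  "cscale a u = fps_const a * u"

interpretation cfps: vector_space cscale
  by unfold_locales
    (simp_all add: cscale_def algebra_simps flip: fps_const_add fps_const_mult)


text \<open>
  A vector of the Hilbert space is a formal power series in \<open>x\<close>. Writing it as the formal sum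
  of \<open>coord q l u n\<close> times the monomial \<open>hbasis q l n\<close>, the space consists of the series
  whose coordinates are square summable, so that the monomials \<open>hbasis q l n\<close> are an
  orthonormal basis.
\<close>

definition cnorm :: "real \<Rightarrow> real \<Rightarrow> nat \<Rightarrow> real" where
  "cnorm q l n =
     q powr ((1 - 2 * l) * real n / 4) * sqrt (qpoch (q powr (2 * l)) q n / qpoch q q n)"

definition hbasis :: "real \<Rightarrow> real \<Rightarrow> nat \<Rightarrow> complex fps" where
  "hbasis q l n = cscale (complex_of_real (cnorm q l n)) (fps_X ^ n)"

definition coord :: "real \<Rightarrow> real \<Rightarrow> complex fps \<Rightarrow> nat \<Rightarrow> complex" where
  "coord q l u n = fps_nth u n / complex_of_real (cnorm q l n)"

definition hspace :: "real \<Rightarrow> real \<Rightarrow> complex fps set" where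
  "hspace q l = {u. summable (\<lambda>n. (cmod (coord q l u n))\<^sup>2)}"

definition hinner :: "real \<Rightarrow> real \<Rightarrow> complex fps \<Rightarrow> complex fps \<Rightarrow> complex" where
  "hinner q l u v = (\<Sum>n. coord q l u n * cnj (coord q l v n))"

definition hnorm :: "real \<Rightarrow> real \<Rightarrow> complex fps \<Rightarrow> real" where
  "hnorm q l u = sqrt (Re (hinner q l u u))"

definition hspan :: "real \<Rightarrow> real \<Rightarrow> complex fps set" where
  "hspan q l = cfps.span (range (hbasis q l))"


text \<open>
  A possibly unbounded operator in the Hilbert space is represented by its graph.
\<close>

type_synonym hop = "(complex fps \<times> complex fps) set"

definition op_closure :: "real \<Rightarrow> real \<Rightarrow> hop \<Rightarrow> hop" where
  "op_closure q l A =
     {(u, v). u \<in> hspace q l \<and> v \<in> hspace q l \<and>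
        (\<exists>U V. (\<forall>k::nat. (U k, V k) \<in> A) \<and>
               (\<lambda>k. hnorm q l (U k - u)) \<longlonglongrightarrow> 0 \<and>
               (\<lambda>k. hnorm q l (V k - v)) \<longlonglongrightarrow> 0)}"

definition op_adjoint :: "real \<Rightarrow> real \<Rightarrow> hop \<Rightarrow> hop" where
  "op_adjoint q l A =
     {(u, v). u \<in> hspace q l \<and> v \<in> hspace q l \<and>
        (\<forall>(x, y) \<in> A. hinner q l y u = hinner q l x v)}"

definition op_selfadjoint :: "real \<Rightarrow> real \<Rightarrow> hop \<Rightarrow> bool" where
  "op_selfadjoint q l A \<longleftrightarrow> op_adjoint q l A = A"

text \<open>
  The library's \<open>cfps.dim\<close> is \<open>0\<close> on infinite-dimensional spaces, hence the detour
  through \<open>enat\<close>.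
\<close>

definition cdim :: "complex fps set \<Rightarrow> enat" where
  "cdim V = (if \<exists>B. finite B \<and> cfps.span B = cfps.span V then enat (cfps.dim V) else \<infinity>)"

definition deficiency_space :: "real \<Rightarrow> real \<Rightarrow> hop \<Rightarrow> complex \<Rightarrow> complex fps set" where
  "deficiency_space q l A z = {u. (u, cscale z u) \<in> op_adjoint q l A}"

definition deficiency_indices :: "real \<Rightarrow> real \<Rightarrow> hop \<Rightarrow> enat \<times> enat" where
  "deficiency_indices q l A =
     (cdim (deficiency_space q l A \<i>), cdim (deficiency_space q l A (- \<i>)))"


text \<open>
  \<open>lin_ext q l \<phi>\<close> is the linear map on \<open>hspan q l\<close> sending \<open>hbasis q l n\<close> to \<open>\<phi> n\<close>;
  it is only meaningful on \<open>hspan q l\<close>, where the sum is finite.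
\<close>

definition lin_ext ::
  "real \<Rightarrow> real \<Rightarrow> (nat \<Rightarrow> complex fps) \<Rightarrow> complex fps \<Rightarrow> complex fps" where
  "lin_ext q l \<phi> p = (\<Sum>n | coord q l p n \<noteq> 0. cscale (coord q l p n) (\<phi> n))"

definition J_plus :: "real \<Rightarrow> real \<Rightarrow> complex fps \<Rightarrow> complex fps" where
  "J_plus q l = lin_ext q l (\<lambda>n.
     cscale (complex_of_real (sqrt (qbracket q (2 * l + real n) * qbracket q (real n + 1))))
       (hbasis q l (n + 1)))"

text \<open>
  For \<open>n = 0\<close> the coefficient vanishes because of \<open>qbracket q 0 = 0\<close>, so the truncated
  subtraction in \<open>n - 1\<close> is harmless.
\<close>

definition J_minus :: "real \<Rightarrow> real \<Rightarrow> complex fps \<Rightarrow> complex fps" where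
  "J_minus q l = lin_ext q l (\<lambda>n.
     cscale (complex_of_real (sqrt (qbracket q (2 * l + real n - 1) * qbracket q (real n))))
       (hbasis q l (n - 1)))"

definition q_pow_J0 :: "real \<Rightarrow> real \<Rightarrow> real \<Rightarrow> complex fps \<Rightarrow> complex fps" where
  "q_pow_J0 q l c = lin_ext q l (\<lambda>n.
     cscale (complex_of_real (q powr (c * (l + real n)))) (hbasis q l n))"

definition I4_fun :: "real \<Rightarrow> real \<Rightarrow> real \<Rightarrow> complex fps \<Rightarrow> complex fps" where
  "I4_fun q l \<psi> p =
     (let w = q_pow_J0 q l (- 1 / 4) p in
      q_pow_J0 q l (- 1 / 4)
        (cscale (exp (\<i> * complex_of_real \<psi>)) (J_plus q l w) +
         cscale (exp (- \<i> * complex_of_real \<psi>)) (J_minus q l w)))"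

definition I4_min :: "real \<Rightarrow> real \<Rightarrow> real \<Rightarrow> hop" where
  "I4_min q l \<psi> = {(p, I4_fun q l \<psi> p) | p. p \<in> hspan q l}"

definition I4 :: "real \<Rightarrow> real \<Rightarrow> real \<Rightarrow> hop" where
  "I4 q l \<psi> = op_closure q l (I4_min q l \<psi>)"


lemma cnorm_pos:
  assumes "0 < q" "q < 1" "0 < l"
  shows "0 < cnorm q l n"
proof -
  have pos: "0 < qpoch a q n" if "0 < a" "a < 1" for a
    unfolding qpoch_def
  proof (rule prod_pos)
    fix r
    have "q ^ r \<le> 1" using assms by (simp add: power_le_one)
    then have "a * q ^ r \<le> a * 1" using that by (intro mult_left_mono) auto
    then show "0 < 1 - a * q ^ r" using that by linarith
  qed
  have "q powr (2 * l) < 1" using assms by (simp add: powr_def mult_pos_neg)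
  then show ?thesis
    unfolding cnorm_def using pos[of q] pos[of "q powr (2 * l)"] assms by simp
qed

lemma coord_add: "coord q l (u + v) n = coord q l u n + coord q l v n"
  by (simp add: coord_def add_divide_distrib)

lemma coord_diff: "coord q l (u - v) n = coord q l u n - coord q l v n"
  by (simp add: coord_def diff_divide_distrib)

lemma coord_cscale: "coord q l (cscale a u) n = a * coord q l u n"
  by (simp add: coord_def cscale_def)

lemma coord_zero: "coord q l 0 n = 0"
  by (simp add: coord_def)

lemma coord_sum: "coord q l (sum f A) n = (\<Sum>i\<in>A. coord q l (f i) n)"
  by (simp add: coord_def fps_sum_nth sum_divide_distrib)

lemma coord_hbasis:
  assumes "0 < q" "q < 1" "0 < l"
  shows "coord q l (hbasis q l m) n = (if m = n then 1 else 0)"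
  using cnorm_pos[OF assms, of n] by (simp add: coord_def hbasis_def cscale_def fps_X_power_nth)

lemma hinner_hbasis_right:
  assumes "0 < q" "q < 1" "0 < l"
  shows "hinner q l u (hbasis q l m) = coord q l u m"
  unfolding hinner_def
  by (subst suminf_finite[of "{m}"]) (auto simp: coord_hbasis[OF assms])

lemma hbasis_orthonormal:
  assumes "0 < q" "q < 1" "0 < l"
  shows "hinner q l (hbasis q l m) (hbasis q l n) = (if m = n then 1 else 0)"
  by (simp add: hinner_hbasis_right[OF assms] coord_hbasis[OF assms])

lemma hbasis_total:
  assumes "0 < q" "q < 1" "0 < l" and "\<And>n. hinner q l u (hbasis q l n) = 0"
  shows "u = 0"
proof (rule fps_ext)
  fix n
  have "coord q l u n = 0" using assms(4) by (simp add: hinner_hbasis_right[OF assms(1-3)])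
  then show "fps_nth u n = fps_nth 0 n"
    using cnorm_pos[OF assms(1-3), of n] by (simp add: coord_def)
qed

lemma finite_coord_hspan:
  assumes "0 < q" "q < 1" "0 < l" and "p \<in> hspan q l"
  shows "finite {n. coord q l p n \<noteq> 0}"
  using assms(4) unfolding hspan_def
proof (induction rule: cfps.span_induct_alt)
  case base
  then show ?case by (simp add: coord_def)
next
  case (step c x y)
  then obtain m where "x = hbasis q l m" by auto
  then have "{n. coord q l (cscale c x + y) n \<noteq> 0} \<subseteq> insert m {n. coord q l y n \<noteq> 0}"
    by (auto simp: coord_add coord_cscale coord_hbasis[OF assms(1-3)])
  then show ?case using step by (meson finite.insertI finite_subset)
qed

lemma hspan_subset_hspace:
  assumes "0 < q" "q < 1" "0 < l"
  shows "hspan q l \<subseteq> hspace q l"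
proof
  fix p assume "p \<in> hspan q l"
  then have "finite {n. coord q l p n \<noteq> 0}" by (rule finite_coord_hspan[OF assms])
  then show "p \<in> hspace q l"
    unfolding hspace_def by (auto intro!: summable_finite)
qed


lemma lin_ext_hbasis:
  assumes "0 < q" "q < 1" "0 < l"
  shows "lin_ext q l \<phi> (hbasis q l n) = \<phi> n"
proof -
  have "{k. coord q l (hbasis q l n) k \<noteq> 0} = {n}"
    by (auto simp: coord_hbasis[OF assms])
  then show ?thesis
    by (simp add: lin_ext_def coord_hbasis[OF assms])
qed

lemma J_plus_hbasis:
  assumes "0 < q" "q < 1" "0 < l"
  shows "J_plus q l (hbasis q l n) =
    cscale (complex_of_real (sqrt (qbracket q (2 * l + real n) * qbracket q (real n + 1))))
      (hbasis q l (n + 1))"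
  by (simp only: J_plus_def lin_ext_hbasis[OF assms])

lemma J_minus_hbasis:
  assumes "0 < q" "q < 1" "0 < l"
  shows "J_minus q l (hbasis q l n) =
    cscale (complex_of_real (sqrt (qbracket q (2 * l + real n - 1) * qbracket q (real n))))
      (hbasis q l (n - 1))"
  by (simp only: J_minus_def lin_ext_hbasis[OF assms])

lemma q_pow_J0_hbasis:
  assumes "0 < q" "q < 1" "0 < l"
  shows "q_pow_J0 q l c (hbasis q l n) =
    cscale (complex_of_real (q powr (c * (l + real n)))) (hbasis q l n)"
  by (simp only: q_pow_J0_def lin_ext_hbasis[OF assms])

lemma coord_lin_ext:
  "coord q l (lin_ext q l \<phi> p) k = (\<Sum>n | coord q l p n \<noteq> 0. coord q l p n * coord q l (\<phi> n) k)"
  by (simp add: lin_ext_def coord_sum coord_cscale)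

lemma coord_q_pow_J0:
  assumes "0 < q" "q < 1" "0 < l" and "finite {n. coord q l p n \<noteq> 0}"
  shows "coord q l (q_pow_J0 q l c p) k = q powr (c * (l + real k)) * coord q l p k"
  using assms(4)
  by (auto simp: q_pow_J0_def coord_lin_ext coord_cscale coord_hbasis[OF assms(1-3)]
      if_distrib[where f = "\<lambda>z. _ * z"] sum.delta cong: if_cong)

lemma coord_J_plus:
  assumes "0 < q" "q < 1" "0 < l" and "finite {n. coord q l p n \<noteq> 0}"
  shows "coord q l (J_plus q l p) k = (if k = 0 then 0 else
    sqrt (qbracket q (2 * l + real (k - 1)) * qbracket q (real (k - 1) + 1)) * coord q l p (k - 1))"
  using assms(4)
  by (cases k) (auto simp: J_plus_def coord_lin_ext coord_cscale coord_hbasis[OF assms(1-3)]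
      if_distrib[where f = "\<lambda>z. _ * z"] sum.delta cong: if_cong)

lemma coord_J_minus:
  assumes "0 < q" "q < 1" "0 < l" and "finite {n. coord q l p n \<noteq> 0}"
  shows "coord q l (J_minus q l p) k =
    sqrt (qbracket q (2 * l + real k) * qbracket q (real k + 1)) * coord q l p (k + 1)"
proof -
  have "coord q l (J_minus q l p) k = (\<Sum>n | coord q l p n \<noteq> 0. if n = k + 1 then
     sqrt (qbracket q (2 * l + real k) * qbracket q (real k + 1)) * coord q l p (k + 1) else 0)"
    unfolding J_minus_def coord_lin_ext
  proof (rule sum.cong)
    fix n
    show "coord q l p n * coord q l (cscale (complex_of_real
        (sqrt (qbracket q (2 * l + real n - 1) * qbracket q (real n)))) (hbasis q l (n - 1))) k =
      (if n = k + 1 then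
       sqrt (qbracket q (2 * l + real k) * qbracket q (real k + 1)) * coord q l p (k + 1) else 0)"
      by (cases n)
        (auto simp: coord_cscale coord_hbasis[OF assms(1-3)] qbracket_def add_ac coord_zero)
  qed simp
  then show ?thesis using assms(4) by (auto simp: sum.delta)
qed


definition I4_entry :: "real \<Rightarrow> real \<Rightarrow> nat \<Rightarrow> real" where
  "I4_entry q l n = q powr (- (1/4) * (l + real n)) * q powr (- (1/4) * (l + real (n + 1)))
     * sqrt (qbracket q (2 * l + real n) * qbracket q (real n + 1))"

lemma coord_I4_fun:
  assumes "0 < q" "q < 1" "0 < l" and "finite {n. coord q l p n \<noteq> 0}"
  shows "coord q l (I4_fun q l \<psi> p) k =
    (if k = 0 then 0 else exp (\<i> * \<psi>) * I4_entry q l (k - 1) * coord q l p (k - 1)) +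
    exp (- \<i> * \<psi>) * I4_entry q l k * coord q l p (k + 1)"
proof -
  note q = assms(1-3)
  define w where "w = q_pow_J0 q l (- 1 / 4) p"
  have w: "coord q l w k = q powr ((- 1 / 4) * (l + real k)) * coord q l p k" for k
    unfolding w_def by (rule coord_q_pow_J0[OF assms])
  have fw: "finite {n. coord q l w n \<noteq> 0}"
    by (rule finite_subset[OF _ assms(4)]) (auto simp: w)
  define v where "v = cscale (exp (\<i> * \<psi>)) (J_plus q l w) + cscale (exp (- \<i> * \<psi>)) (J_minus q l w)"
  have v: "coord q l v k = (if k = 0 then 0 else exp (\<i> * \<psi>) *
      (sqrt (qbracket q (2 * l + real (k - 1)) * qbracket q (real (k - 1) + 1)) * coord q l w (k - 1)))
      + exp (- \<i> * \<psi>) * (sqrt (qbracket q (2 * l + real k) * qbracket q (real k + 1)) * coord q l w (k + 1))"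
    for k
    unfolding v_def coord_add coord_cscale coord_J_plus[OF q fw] coord_J_minus[OF q fw] by simp
  have "{n. coord q l v n \<noteq> 0} \<subseteq>
      Suc ` {n. coord q l w n \<noteq> 0} \<union> (\<lambda>n. n - 1) ` {n. coord q l w n \<noteq> 0}"
  proof
    fix n assume "n \<in> {n. coord q l v n \<noteq> 0}"
    then have "(n \<noteq> 0 \<and> coord q l w (n - 1) \<noteq> 0) \<or> coord q l w (n + 1) \<noteq> 0"
      by (auto simp: v split: if_splits)
    then show "n \<in> Suc ` {n. coord q l w n \<noteq> 0} \<union> (\<lambda>n. n - 1) ` {n. coord q l w n \<noteq> 0}"
    proof
      assume "n \<noteq> 0 \<and> coord q l w (n - 1) \<noteq> 0"
      then show ?thesis by (intro UnI1 image_eqI[of _ _ "n - 1"]) auto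
    next
      assume "coord q l w (n + 1) \<noteq> 0"
      then show ?thesis by (intro UnI2 image_eqI[of _ _ "n + 1"]) auto
    qed
  qed
  then have fv: "finite {n. coord q l v n \<noteq> 0}"
    using fw by (meson finite_UnI finite_imageI finite_subset)
  have "I4_fun q l \<psi> p = q_pow_J0 q l (- 1 / 4) v"
    by (simp add: I4_fun_def Let_def v_def w_def)
  then show ?thesis
    by (simp add: coord_q_pow_J0[OF q fv] v w I4_entry_def algebra_simps)
qed

lemma finite_coord_I4_fun:
  assumes "0 < q" "q < 1" "0 < l" and "p \<in> hspan q l"
  shows "finite {n. coord q l (I4_fun q l \<psi> p) n \<noteq> 0}"
proof -
  note fp = finite_coord_hspan[OF assms]
  then obtain N where "\<And>n. coord q l p n \<noteq> 0 \<Longrightarrow> n < N"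
    using finite_nat_set_iff_bounded by auto
  then have "coord q l p n = 0" if "N \<le> n" for n using that not_less by blast
  then have "coord q l (I4_fun q l \<psi> p) n = 0" if "Suc N \<le> n" for n
    using that by (simp add: coord_I4_fun[OF assms(1-3) fp])
  then have "{n. coord q l (I4_fun q l \<psi> p) n \<noteq> 0} \<subseteq> {..N}"
    using not_less_eq_eq by auto
  then show ?thesis using finite_subset by blast
qed

lemma I4_min_subset_hspace:
  assumes "0 < q" "q < 1" "0 < l"
  shows "I4_min q l \<psi> \<subseteq> hspace q l \<times> hspace q l"
proof -
  have "I4_fun q l \<psi> p \<in> hspace q l" if "p \<in> hspan q l" for p
    using finite_coord_I4_fun[OF assms that, of \<psi>]
    unfolding hspace_def by (auto intro!: summable_finite)
  then show ?thesis
    using hspan_subset_hspace[OF assms] by (auto simp: I4_min_def)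
qed

theorem I4_min_symmetric:
  assumes "0 < q" "q < 1" "0 < l" and "(u, v) \<in> I4_min q l \<psi>" and "(x, y) \<in> I4_min q l \<psi>"
  shows "hinner q l v x = hinner q l u y"
proof -
  note q = assms(1-3)
  have u: "u \<in> hspan q l" "v = I4_fun q l \<psi> u" and x: "x \<in> hspan q l" "y = I4_fun q l \<psi> x"
    using assms(4,5) by (auto simp: I4_min_def)
  note fu = finite_coord_hspan[OF q u(1)] and fx = finite_coord_hspan[OF q x(1)]
  have fin: "finite ({n. coord q l u n \<noteq> 0} \<union> {n. coord q l x n \<noteq> 0})" using fu fx by simp
  then obtain N where N: "\<And>n. n \<in> {n. coord q l u n \<noteq> 0} \<union> {n. coord q l x n \<noteq> 0} \<Longrightarrow> n < N"
    using finite_nat_set_iff_bounded by auto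
  have z: "coord q l u n = 0" "coord q l x n = 0" if "N \<le> n" for n
    using N[of n] that by auto
  define a where "a = I4_entry q l"
  define e where "e = exp (\<i> * \<psi>)"
  define e' where "e' = exp (- \<i> * \<psi>)"
  have ee: "cnj e = e'" "cnj e' = e" by (simp_all add: e_def e'_def exp_cnj)
  define U where "U = coord q l u"
  define X where "X = coord q l x"
  have cv: "coord q l v k = (if k = 0 then 0 else e * a (k - 1) * U (k - 1)) + e' * a k * U (k + 1)" for k
    unfolding u(2) coord_I4_fun[OF q fu] a_def e_def e'_def U_def by simp
  have cy: "coord q l y k = (if k = 0 then 0 else e * a (k - 1) * X (k - 1)) + e' * a k * X (k + 1)" for k
    unfolding x(2) coord_I4_fun[OF q fx] a_def e_def e'_def X_def by simp
  have "hinner q l v x = (\<Sum>n<Suc N. coord q l v n * cnj (X n))"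
    unfolding hinner_def X_def by (rule suminf_finite) (auto simp: z)
  also have "\<dots> = (\<Sum>n<Suc N. (if n = 0 then 0 else e * a (n - 1) * U (n - 1)) * cnj (X n))
      + (\<Sum>n<Suc N. e' * a n * U (n + 1) * cnj (X n))"
    by (simp only: cv distrib_right sum.distrib)
  also have "(\<Sum>n<Suc N. (if n = 0 then 0 else e * a (n - 1) * U (n - 1)) * cnj (X n))
      = (\<Sum>n<N. e * a n * U n * cnj (X (n + 1)))"
    by (simp add: sum.lessThan_Suc_shift del: sum.lessThan_Suc)
  also have "\<dots> = (\<Sum>n<Suc N. U n * cnj (e' * a n * X (n + 1)))"
    by (simp add: X_def z ee mult_ac)
  also have "(\<Sum>n<Suc N. e' * a n * U (n + 1) * cnj (X n))
      = (\<Sum>n<N. e' * a n * U (n + 1) * cnj (X n))"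
    by (simp add: U_def z)
  also have "\<dots> = (\<Sum>n<Suc N. U n * cnj (if n = 0 then 0 else e * a (n - 1) * X (n - 1)))"
    by (simp add: sum.lessThan_Suc_shift ee mult_ac del: sum.lessThan_Suc)
  also have "(\<Sum>n<Suc N. U n * cnj (e' * a n * X (n + 1))) + \<dots>
      = (\<Sum>n<Suc N. U n * cnj (if n = 0 then 0 else e * a (n - 1) * X (n - 1)))
      + (\<Sum>n<Suc N. U n * cnj (e' * a n * X (n + 1)))"
    by (rule add.commute)
  also have "\<dots> = (\<Sum>n<Suc N. U n * cnj (coord q l y n))"
    by (simp only: cy complex_cnj_add distrib_left sum.distrib)
  also have "\<dots> = hinner q l u y"
    unfolding hinner_def U_def by (rule suminf_finite[symmetric]) (auto simp: z)
  finally show ?thesis .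
qed

lemma hspace_diff:
  assumes "u \<in> hspace q l" "v \<in> hspace q l"
  shows "u - v \<in> hspace q l"
proof -
  have "summable (\<lambda>n. 2 * (cmod (coord q l u n))\<^sup>2 + 2 * (cmod (coord q l v n))\<^sup>2)"
    using assms unfolding hspace_def by (intro summable_add summable_mult) auto
  moreover have "norm ((cmod (coord q l (u - v) n))\<^sup>2)
      \<le> 2 * (cmod (coord q l u n))\<^sup>2 + 2 * (cmod (coord q l v n))\<^sup>2" for n
  proof -
    have "(cmod (coord q l (u - v) n))\<^sup>2 \<le> (cmod (coord q l u n) + cmod (coord q l v n))\<^sup>2"
      by (intro power_mono) (auto simp: coord_diff norm_triangle_ineq4)
    also have "\<dots> \<le> 2 * (cmod (coord q l u n))\<^sup>2 + 2 * (cmod (coord q l v n))\<^sup>2"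
      using zero_le_power2[of "cmod (coord q l u n) - cmod (coord q l v n)"]
      by (simp add: power2_eq_square algebra_simps)
    finally show ?thesis by simp
  qed
  ultimately show ?thesis
    unfolding hspace_def by (auto intro: summable_comparison_test')
qed

lemma norm_coord_le_hnorm:
  assumes "u \<in> hspace q l"
  shows "cmod (coord q l u n) \<le> hnorm q l u"
proof -
  have s: "summable (\<lambda>n. (cmod (coord q l u n))\<^sup>2)" using assms by (simp add: hspace_def)
  have "hinner q l u u = (\<Sum>n. complex_of_real ((cmod (coord q l u n))\<^sup>2))"
    by (simp only: hinner_def complex_norm_square)
  also have "\<dots> = complex_of_real (\<Sum>n. (cmod (coord q l u n))\<^sup>2)"
    using s by (rule suminf_of_real[symmetric])
  finally have "hnorm q l u = sqrt (\<Sum>n. (cmod (coord q l u n))\<^sup>2)"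
    by (simp add: hnorm_def)
  moreover have "(cmod (coord q l u n))\<^sup>2 \<le> (\<Sum>n. (cmod (coord q l u n))\<^sup>2)"
    using sum_le_suminf[OF s, of "{n}"] by simp
  ultimately show ?thesis by (simp add: real_le_rsqrt)
qed

lemma coord_tendsto:
  assumes "\<And>k. U k \<in> hspace q l" "u \<in> hspace q l" "(\<lambda>k. hnorm q l (U k - u)) \<longlonglongrightarrow> 0"
  shows "(\<lambda>k. coord q l (U k) n) \<longlonglongrightarrow> coord q l u n"
proof (rule LIM_zero_cancel, rule Lim_null_comparison[OF _ assms(3)], rule always_eventually, rule allI)
  fix k
  show "norm (coord q l (U k) n - coord q l u n) \<le> hnorm q l (U k - u)"
    using norm_coord_le_hnorm[OF hspace_diff[OF assms(1)[of k] assms(2)], of n]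
    by (simp add: coord_diff)
qed

theorem I4_single_valued:
  assumes "0 < q" "q < 1" "0 < l"
  shows "single_valued (I4 q l \<psi>)"
proof -
  have c: "coord q l v n =
      (if n = 0 then 0 else exp (\<i> * \<psi>) * I4_entry q l (n - 1) * coord q l u (n - 1)) +
      exp (- \<i> * \<psi>) * I4_entry q l n * coord q l u (n + 1)"
    if "(u, v) \<in> I4 q l \<psi>" for u v n
  proof -
    from that obtain U V where h: "u \<in> hspace q l" "v \<in> hspace q l"
      and UV: "\<And>k. (U k, V k) \<in> I4_min q l \<psi>"
      and lim: "(\<lambda>k. hnorm q l (U k - u)) \<longlonglongrightarrow> 0" "(\<lambda>k. hnorm q l (V k - v)) \<longlonglongrightarrow> 0"
      unfolding I4_def op_closure_def by auto
    have m: "U k \<in> hspace q l" "V k \<in> hspace q l" for k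
      using UV[of k] I4_min_subset_hspace[OF assms] by auto
    note tU = coord_tendsto[OF m(1) h(1) lim(1)] and tV = coord_tendsto[OF m(2) h(2) lim(2)]
    have s: "U k \<in> hspan q l" "V k = I4_fun q l \<psi> (U k)" for k
      using UV[of k] by (auto simp: I4_min_def)
    have "(\<lambda>k. coord q l (V k) n) \<longlonglongrightarrow>
      (if n = 0 then 0 else exp (\<i> * \<psi>) * I4_entry q l (n - 1) * coord q l u (n - 1)) +
      exp (- \<i> * \<psi>) * I4_entry q l n * coord q l u (n + 1)"
      unfolding s(2) coord_I4_fun[OF assms finite_coord_hspan[OF assms s(1)]]
      by (cases "n = 0") (auto intro!: tendsto_intros tU)
    then show ?thesis using tV LIMSEQ_unique by blast
  qed
  show ?thesis
  proof (rule single_valuedI)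
    fix u v v' assume a: "(u, v) \<in> I4 q l \<psi>" "(u, v') \<in> I4 q l \<psi>"
    show "v = v'"
    proof (rule fps_ext)
      fix n
      have "coord q l v n = coord q l v' n" using c[OF a(1)] c[OF a(2)] by metis
      then show "fps_nth v n = fps_nth v' n"
        using cnorm_pos[OF assms, of n] by (simp add: coord_def)
    qed
  qed
qed

end

theory Submission
  imports Defs
begin

text \<open>
  In the orthonormal basis the operator is, up to phases, the Jacobi matrix with zero diagonal and
  off-diagonal entries \<open>a n\<close>, which grow like \<open>q\<close> to the power \<open>-n\<close>.
  A vector lies in the deficiency space for \<open>z\<close> iff its coordinates solve
  \<open>a (n + 1) * X (n + 2) = z * X (n + 1) - a n * X n\<close> (phases omitted) with the initial
  condition at \<open>0\<close>, so that the solution is unique up to a scalar, and are square summable.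
  Since \<open>a n / a (n + 1) \<le> q\<close> and \<open>z / a n\<close> tends to \<open>0\<close>, every solution decays
  geometrically; hence both deficiency spaces are one-dimensional. A selfadjoint operator is
  symmetric and so has no eigenvector for the eigenvalue \<open>\<i>\<close>.
\<close>

section \<open>Coordinates, norm and inner product of the Hilbert space\<close>

lemma coord_eqI:
  assumes "0 < q" "q < 1" "0 < l" and "\<And>n. coord q l u n = coord q l v n"
  shows "u = v"
proof (rule fps_ext)
  fix n
  show "fps_nth u n = fps_nth v n"
    using cnorm_pos[OF assms(1-3), of n] assms(4)[of n] by (simp add: coord_def)
qed

lemma hspace_cscale:
  assumes "u \<in> hspace q l"
  shows "cscale z u \<in> hspace q l"
  using assms by (auto simp: hspace_def coord_cscale norm_mult power_mult_distrib intro: summable_mult)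

lemma hbasis_in_hspan: "hbasis q l n \<in> hspan q l"
  unfolding hspan_def by (intro cfps.span_base) simp

lemma hnorm_eq:
  assumes "u \<in> hspace q l"
  shows "hnorm q l u = sqrt (\<Sum>n. (cmod (coord q l u n))\<^sup>2)"
proof -
  have s: "summable (\<lambda>n. (cmod (coord q l u n))\<^sup>2)" using assms by (simp add: hspace_def)
  have "hinner q l u u = (\<Sum>n. complex_of_real ((cmod (coord q l u n))\<^sup>2))"
    by (simp only: hinner_def complex_norm_square)
  also have "\<dots> = complex_of_real (\<Sum>n. (cmod (coord q l u n))\<^sup>2)"
    using s by (rule suminf_of_real[symmetric])
  finally show ?thesis by (simp add: hnorm_def)
qed

text \<open>The finite Cauchy-Schwarz inequality for \<open>L2_set\<close> bounds all partial sums
  of the absolute values uniformly in \<open>N\<close>, which yields convergence and the estimate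
  together. Convergence is recorded because later termwise manipulations of \<open>hinner\<close>
  rely on it.\<close>

lemma hinner_Cauchy_Schwarz:
  assumes "u \<in> hspace q l" "v \<in> hspace q l"
  shows "summable (\<lambda>n. coord q l u n * cnj (coord q l v n))" (is ?S)
    and "cmod (hinner q l u v) \<le> hnorm q l u * hnorm q l v" (is ?N)
proof -
  let ?f = "\<lambda>n. norm (coord q l u n * cnj (coord q l v n))"
  have su: "summable (\<lambda>n. (cmod (coord q l u n))\<^sup>2)" and sv: "summable (\<lambda>n. (cmod (coord q l v n))\<^sup>2)"
    using assms by (simp_all add: hspace_def)
  have bound: "(\<Sum>n<N. ?f n) \<le> hnorm q l u * hnorm q l v" for N
  proof -
    have L: "L2_set (\<lambda>n. cmod (coord q l w n)) {..<N} \<le> hnorm q l w" if "w \<in> hspace q l" for w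
      using that unfolding L2_set_def hnorm_eq[OF that] hspace_def
      by (intro real_sqrt_le_mono sum_le_suminf) auto
    have "(\<Sum>n<N. ?f n) \<le> L2_set (\<lambda>n. cmod (coord q l u n)) {..<N} * L2_set (\<lambda>n. cmod (coord q l v n)) {..<N}"
      using L2_set_mult_ineq[of "\<lambda>n. cmod (coord q l u n)" "\<lambda>n. cmod (coord q l v n)" "{..<N}"]
      by (simp add: norm_mult)
    also have "\<dots> \<le> hnorm q l u * hnorm q l v"
      using L[OF assms(1)] L[OF assms(2)] L2_set_nonneg
      by (intro mult_mono) (auto intro: order_trans[OF L2_set_nonneg])
    finally show ?thesis .
  qed
  have sf: "summable ?f"
    by (rule bounded_imp_summable[where B = "hnorm q l u * hnorm q l v"])
      (use bound[of "Suc _"] in \<open>auto simp: lessThan_Suc_atMost\<close>)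
  then show ?S by (rule summable_norm_cancel)
  have "cmod (hinner q l u v) \<le> (\<Sum>n. ?f n)"
    unfolding hinner_def by (rule summable_norm[OF sf])
  also have "\<dots> \<le> hnorm q l u * hnorm q l v"
    using bound sf by (intro suminf_le_const) auto
  finally show ?N .
qed

lemma tendsto_hinner_left:
  assumes "\<And>k. U k \<in> hspace q l" "u \<in> hspace q l" "w \<in> hspace q l"
    and "(\<lambda>k. hnorm q l (U k - u)) \<longlonglongrightarrow> 0"
  shows "(\<lambda>k. hinner q l (U k) w) \<longlonglongrightarrow> hinner q l u w"
proof (rule LIM_zero_cancel, rule Lim_null_comparison[OF always_eventually], rule allI)
  fix k
  have "hinner q l (U k) w - hinner q l u w = hinner q l (U k - u) w"
    unfolding hinner_def
    using suminf_diff[OF hinner_Cauchy_Schwarz(1)[OF assms(1)[of k] assms(3)]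
        hinner_Cauchy_Schwarz(1)[OF assms(2,3)]]
    by (simp add: coord_diff left_diff_distrib)
  then show "norm (hinner q l (U k) w - hinner q l u w) \<le> hnorm q l (U k - u) * hnorm q l w"
    using hinner_Cauchy_Schwarz(2)[OF hspace_diff[OF assms(1)[of k] assms(2)] assms(3)] by simp
next
  show "(\<lambda>k. hnorm q l (U k - u) * hnorm q l w) \<longlonglongrightarrow> 0"
    using tendsto_mult_left_zero[OF assms(4)] by simp
qed

section \<open>Closures and adjoints of graphs\<close>

lemma op_closure_superset:
  assumes "A \<subseteq> hspace q l \<times> hspace q l"
  shows "A \<subseteq> op_closure q l A"
proof
  fix p assume p: "p \<in> A"
  obtain u v where uv: "p = (u, v)" by (cases p)
  have "hnorm q l 0 = 0" by (simp add: hnorm_def hinner_def coord_zero)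
  then have "\<exists>U V. (\<forall>k::nat. (U k, V k) \<in> A) \<and> (\<lambda>k. hnorm q l (U k - u)) \<longlonglongrightarrow> 0 \<and>
      (\<lambda>k. hnorm q l (V k - v)) \<longlonglongrightarrow> 0"
    using p uv by (intro exI[of _ "\<lambda>_. u"] exI[of _ "\<lambda>_. v"]) simp
  then show "p \<in> op_closure q l A"
    using p assms uv by (auto simp: op_closure_def)
qed

text \<open>The adjoint relation survives limits of graph points, by continuity of the inner product
  in its first argument. Hence the adjoint of a closure can be computed on the original
  graph.\<close>

lemma op_adjoint_op_closure:
  assumes "A \<subseteq> hspace q l \<times> hspace q l"
  shows "op_adjoint q l (op_closure q l A) = op_adjoint q l A"
proof
  show "op_adjoint q l (op_closure q l A) \<subseteq> op_adjoint q l A"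
    using op_closure_superset[OF assms] unfolding op_adjoint_def by blast
  show "op_adjoint q l A \<subseteq> op_adjoint q l (op_closure q l A)"
  proof (rule subrelI)
    fix u v assume uv: "(u, v) \<in> op_adjoint q l A"
    have h: "u \<in> hspace q l" "v \<in> hspace q l" using uv by (auto simp: op_adjoint_def)
    have "hinner q l y u = hinner q l x v" if xyA: "(x, y) \<in> op_closure q l A" for x y
    proof -
      obtain X Y where xy: "x \<in> hspace q l" "y \<in> hspace q l" and A: "\<And>k::nat. (X k, Y k) \<in> A"
        and lim: "(\<lambda>k. hnorm q l (X k - x)) \<longlonglongrightarrow> 0" "(\<lambda>k. hnorm q l (Y k - y)) \<longlonglongrightarrow> 0"
        using xyA unfolding op_closure_def by blast
      have XY: "X k \<in> hspace q l" "Y k \<in> hspace q l" for k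
        using A[of k] assms by auto
      have "hinner q l (Y k) u = hinner q l (X k) v" for k
        using uv A[of k] by (auto simp: op_adjoint_def)
      then have "(\<lambda>k. hinner q l (Y k) u) \<longlonglongrightarrow> hinner q l x v"
        using tendsto_hinner_left[OF XY(1) xy(1) h(2) lim(1)] by simp
      then show ?thesis
        using tendsto_hinner_left[OF XY(2) xy(2) h(1) lim(2)] LIMSEQ_unique by blast
    qed
    then show "(u, v) \<in> op_adjoint q l (op_closure q l A)"
      using h by (auto simp: op_adjoint_def)
  qed
qed

section \<open>The adjoint as a formal Jacobi matrix\<close>

text \<open>Formal action of a Hermitian tridiagonal matrix with zero diagonal. Rows are finite, so
  it applies to any sequence, not only to finitely supported ones.\<close>

definition jacobi :: "(nat \<Rightarrow> real) \<Rightarrow> complex \<Rightarrow> (nat \<Rightarrow> complex) \<Rightarrow> nat \<Rightarrow> complex" where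
  "jacobi a e X k = (if k = 0 then 0 else e * a (k - 1) * X (k - 1)) + cnj e * a k * X (k + 1)"

text \<open>Discrete Green formula: the terms telescope to a Wronskian-type boundary term, which
  vanishes as soon as \<open>X\<close> is zero at \<open>M\<close> and \<open>M + 1\<close>.\<close>

lemma jacobi_Green_identity:
  "(\<Sum>n\<le>M. jacobi a e X n * cnj (Y n) - X n * cnj (jacobi a e Y n)) =
     a M * (cnj e * X (M + 1) * cnj (Y M) - e * X M * cnj (Y (M + 1)))"
  by (induction M) (simp_all add: jacobi_def algebra_simps)

lemma coord_I4_fun_jacobi:
  assumes "0 < q" "q < 1" "0 < l" and "p \<in> hspan q l"
  shows "coord q l (I4_fun q l \<psi> p) = jacobi (I4_entry q l) (exp (\<i> * \<psi>)) (coord q l p)"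
  using coord_I4_fun[OF assms(1-3) finite_coord_hspan[OF assms]]
  by (auto simp: jacobi_def exp_cnj)

text \<open>On finitely supported vectors the Green formula has no boundary term, and testing
  against basis vectors recovers every coordinate of \<open>v\<close>. So the adjoint is the maximal
  operator of the formal matrix, its domain restricted by square summability alone.\<close>

lemma op_adjoint_I4:
  assumes q: "0 < q" "q < 1" "0 < l"
  shows "(u, v) \<in> op_adjoint q l (I4 q l \<psi>) \<longleftrightarrow> u \<in> hspace q l \<and> v \<in> hspace q l \<and>
     (\<forall>n. coord q l v n = jacobi (I4_entry q l) (exp (\<i> * \<psi>)) (coord q l u) n)"
    (is "_ \<longleftrightarrow> _ \<and> _ \<and> (\<forall>n. _ = ?J u n)")
proof -
  have fin: "hinner q l (I4_fun q l \<psi> p) u - hinner q l p v =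
      (\<Sum>n. coord q l p n * cnj (?J u n - coord q l v n))" (is ?eq)
    and "finite {n. coord q l p n \<noteq> 0}" if p: "p \<in> hspan q l" for p
  proof -
    show f: "finite {n. coord q l p n \<noteq> 0}" by (rule finite_coord_hspan[OF q p])
    obtain N where "\<forall>n\<in>{n. coord q l p n \<noteq> 0}. n < N"
      using f finite_nat_set_iff_bounded by blast
    then have z: "coord q l p n = 0" if "N \<le> n" for n
      using that not_less by blast
    note c = coord_I4_fun_jacobi[OF q p, of \<psi>]
    \<comment> \<open>The support of \<open>p\<close> lies below \<open>N\<close> and the matrix
      extends it by at most one index, so sums over \<open>{..N}\<close> lose nothing.\<close>
    have zI: "coord q l (I4_fun q l \<psi> p) n = 0" if "n \<notin> {..N}" for n
      using that z[of "n - 1"] z[of "n + 1"] by (simp add: c jacobi_def)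
    have "hinner q l (I4_fun q l \<psi> p) u - hinner q l p v =
        (\<Sum>n\<le>N. ?J p n * cnj (coord q l u n)) - (\<Sum>n\<le>N. coord q l p n * cnj (coord q l v n))"
      unfolding hinner_def
      by (subst (1 2) suminf_finite[of "{..N}"]) (auto simp: z zI c[symmetric])
    also have "\<dots> = (\<Sum>n\<le>N. ?J p n * cnj (coord q l u n) - coord q l p n * cnj (?J u n)) +
        (\<Sum>n\<le>N. coord q l p n * cnj (?J u n - coord q l v n))"
      by (simp add: sum_subtractf sum.distrib[symmetric] algebra_simps)
    also have "\<dots> = (\<Sum>n\<le>N. coord q l p n * cnj (?J u n - coord q l v n))"
      by (simp add: jacobi_Green_identity z)
    also have "\<dots> = (\<Sum>n. coord q l p n * cnj (?J u n - coord q l v n))"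
      by (rule suminf_finite[symmetric]) (auto simp: z)
    finally show ?eq .
  qed
  have "(\<forall>p\<in>hspan q l. hinner q l (I4_fun q l \<psi> p) u = hinner q l p v) \<longleftrightarrow>
      (\<forall>n. coord q l v n = ?J u n)" (is "?L \<longleftrightarrow> ?R")
  proof
    assume L: ?L
    show ?R
    proof
      fix m
      have "0 = (\<Sum>n. coord q l (hbasis q l m) n * cnj (?J u n - coord q l v n))"
        using fin[OF hbasis_in_hspan[of q l m]] L hbasis_in_hspan[of q l m] by simp
      also have "\<dots> = cnj (?J u m - coord q l v m)"
        by (subst suminf_finite[of "{m}"]) (auto simp: coord_hbasis[OF q])
      finally show "coord q l v m = ?J u m"
        by (metis complex_cnj_zero_iff eq_iff_diff_eq_0)
    qed
  next
    assume R: ?R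
    show ?L
    proof
      fix p assume "p \<in> hspan q l"
      from fin[OF this] R show "hinner q l (I4_fun q l \<psi> p) u = hinner q l p v" by simp
    qed
  qed
  then show ?thesis
    unfolding I4_def op_adjoint_op_closure[OF I4_min_subset_hspace[OF q]]
    by (auto simp: op_adjoint_def I4_min_def)
qed

section \<open>Growth of the off-diagonal entries\<close>

lemma qbracket_eq:
  assumes "0 < q" "q < 1"
  shows "qbracket q c = q powr ((1 - c) / 2) * ((1 - q powr c) / (1 - q))"
proof -
  have "q powr (c / 2) - q powr (- c / 2) = - (q powr (- c / 2) * (1 - q powr c))"
    by (simp add: algebra_simps powr_add[symmetric])
  moreover have "q powr (1 / 2) - q powr (- 1 / 2) = - (q powr (- 1 / 2) * (1 - q))"
    using assms powr_add[of q "-1/2" 1] by (simp add: algebra_simps)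
  moreover have "q powr (- c / 2) = q powr (- 1 / 2) * q powr ((1 - c) / 2)"
    by (simp add: powr_add[symmetric] field_simps)
  ultimately show ?thesis
    using assms by (simp add: qbracket_def)
qed

text \<open>The powers of \<open>q\<close> from the two brackets and from the two outer factors
  combine to the exponent \<open>- l - n\<close>. This isolates the geometric growth; the remaining
  square root tends to 1.\<close>

lemma I4_entry_eq:
  assumes "0 < q" "q < 1" "0 < l"
  shows "I4_entry q l n =
    q powr (- l) / (1 - q) / q ^ n * sqrt ((1 - q powr (2 * l) * q ^ n) * (1 - q * q ^ n))"
proof -
  have "qbracket q (2 * l + real n) * qbracket q (real n + 1) =
      (q powr ((1 - 2 * l - 2 * real n) / 4) / (1 - q))\<^sup>2 * ((1 - q powr (2 * l) * q ^ n) * (1 - q * q ^ n))"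
  proof -
    have "q powr ((1 - (2 * l + real n)) / 2) * q powr ((1 - (real n + 1)) / 2) =
        (q powr ((1 - 2 * l - 2 * real n) / 4))\<^sup>2"
      unfolding power2_eq_square powr_add[symmetric]
      by (rule arg_cong[where f = "(powr) q"]) (simp add: field_simps)
    moreover have "q powr (2 * l + real n) = q powr (2 * l) * q ^ n" "q powr (real n + 1) = q * q ^ n"
      using assms by (simp_all add: powr_add powr_realpow)
    ultimately show ?thesis
      unfolding qbracket_eq[OF assms(1,2)] by (simp add: power_divide power2_eq_square)
  qed
  then have "sqrt (qbracket q (2 * l + real n) * qbracket q (real n + 1)) =
      q powr ((1 - 2 * l - 2 * real n) / 4) / (1 - q) * sqrt ((1 - q powr (2 * l) * q ^ n) * (1 - q * q ^ n))"
    using assms by (simp add: real_sqrt_mult)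
  moreover have "q powr (- (1/4) * (l + real n)) * q powr (- (1/4) * (l + real (n + 1)))
      * q powr ((1 - 2 * l - 2 * real n) / 4) = q powr (- l) / q ^ n"
    using assms unfolding powr_realpow[OF assms(1), symmetric] powr_add[symmetric] powr_diff[symmetric]
    by (intro arg_cong[where f = "(powr) q"]) (simp add: field_simps)
  \<comment> \<open>Pure regrouping, so that only the product of the three powers has to be
    evaluated.\<close>
  moreover have "x * y * (w / c * s) = t / c / d * s" if "x * y * w = t / d" for x y w c d s t :: real
    using arg_cong[OF that, of "\<lambda>h. h / c * s"] by (simp add: ac_simps)
  ultimately show ?thesis
    unfolding I4_entry_def by presburger
qed

text \<open>The prefactor grows by exactly \<open>1 / q\<close> per step while the square root
  increases with \<open>n\<close>; iterating the resulting ratio bound gives the third claim. Square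
  summability of the eigenvectors uses nothing else about the entries.\<close>

lemma
  assumes "0 < q" "q < 1" "0 < l"
  shows I4_entry_pos: "0 < I4_entry q l n"
    and I4_entry_ratio: "I4_entry q l n \<le> q * I4_entry q l (Suc n)"
    and I4_entry_lower_bound: "I4_entry q l 0 \<le> q ^ n * I4_entry q l n"
proof -
  define b where "b = q powr (2 * l)"
  have b: "0 < b" "b < 1" using assms by (auto simp: b_def powr_def mult_pos_neg)
  have lt: "c * q ^ k < 1" if "0 < c" "c < 1" for c k
    using that assms mult_strict_mono[of c 1 "q ^ k" 1] power_le_one[of q k]
    by (metis less_eq_real_def mult.right_neutral mult_le_cancel_left_pos order_le_less_trans)
  show pos: "0 < I4_entry q l n" for n
    unfolding I4_entry_eq[OF assms] b_def[symmetric]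
    using assms b lt[of b n] lt[of q n] by simp
  show ratio: "I4_entry q l n \<le> q * I4_entry q l (Suc n)" for n
  proof -
    have "q ^ Suc n \<le> q ^ n" using assms by (simp add: mult_left_le_one_le)
    then have "(1 - b * q ^ n) * (1 - q * q ^ n) \<le> (1 - b * q ^ Suc n) * (1 - q * q ^ Suc n)"
      using assms b lt[of q n] lt[of b "Suc n"]
      by (intro mult_mono) (auto intro!: mult_left_mono simp del: power_Suc)
    then have "q powr (- l) / (1 - q) / q ^ n * sqrt ((1 - b * q ^ n) * (1 - q * q ^ n)) \<le>
        q powr (- l) / (1 - q) / q ^ n * sqrt ((1 - b * q ^ Suc n) * (1 - q * q ^ Suc n))"
      using assms by (intro mult_left_mono real_sqrt_le_mono) auto
    also have "\<dots> = q * (q powr (- l) / (1 - q) / q ^ Suc n * sqrt ((1 - b * q ^ Suc n) * (1 - q * q ^ Suc n)))"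
      using assms by simp
    finally show ?thesis
      unfolding I4_entry_eq[OF assms] b_def[symmetric] .
  qed
  show "I4_entry q l 0 \<le> q ^ n * I4_entry q l n"
  proof (induction n)
    case (Suc n)
    have "q ^ n * I4_entry q l n \<le> q ^ n * (q * I4_entry q l (Suc n))"
      using assms ratio[of n] by (intro mult_left_mono) auto
    with Suc show ?case by (simp add: mult_ac)
  qed simp
qed

section \<open>The three-term recurrence for eigenvectors\<close>

lemma jacobi_mult: "jacobi a e (\<lambda>n. c * X n) k = c * jacobi a e X k"
  by (simp add: jacobi_def algebra_simps)

text \<open>Up to phases, the orthonormal polynomials of the Jacobi matrix evaluated at
  \<open>z\<close>. The factor \<open>e\<close> stands for division by \<open>cnj e\<close>, which
  is the same when \<open>cmod e = 1\<close>.\<close>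

fun jacobi_solution :: "(nat \<Rightarrow> real) \<Rightarrow> complex \<Rightarrow> complex \<Rightarrow> nat \<Rightarrow> complex" where
  "jacobi_solution a e z 0 = 1"
| "jacobi_solution a e z (Suc 0) = e * z / a 0"
| "jacobi_solution a e z (Suc (Suc n)) =
     e * (z * jacobi_solution a e z (Suc n) - e * a n * jacobi_solution a e z n) / a (Suc n)"

text \<open>Row 0 determines \<open>X 1\<close> and row \<open>n + 1\<close> determines
  \<open>X (n + 2)\<close>, because no \<open>a n\<close> vanishes. The only free parameter is
  \<open>X 0\<close>, which caps the dimension of a deficiency space at one.\<close>

lemma jacobi_eigen_iff:
  assumes "\<And>n. 0 < a n" "cmod e = 1"
  shows "(\<forall>n. jacobi a e X n = z * X n) \<longleftrightarrow> X = (\<lambda>n. X 0 * jacobi_solution a e z n)"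
    (is "?L \<longleftrightarrow> ?R")
proof -
  have ee: "cnj e * e = 1" "e * cnj e = 1"
    using assms(2) complex_norm_square[of e] by (simp_all add: mult.commute)
  have e0: "e \<noteq> 0" using ee by auto
  have ce: "cnj e = inverse e" using ee(1) by (metis inverse_unique mult.commute)
  have a0: "a n \<noteq> 0" for n using assms(1)[of n] by simp
  show ?thesis
  proof
    assume L: ?L
    have "X n = X 0 * jacobi_solution a e z n" for n
    proof (induction n rule: induct_nat_012)
      case 1
      show ?case using L[rule_format, of 0] a0 e0 by (simp add: jacobi_def ce field_simps)
    next
      case (ge2 n)
      show ?case
        using L[rule_format, of "Suc n"] a0 e0 ge2 by (simp add: jacobi_def ce field_simps)
    qed simp
    then show ?R by (rule ext)
  next
    assume R: ?R
    have "jacobi a e (jacobi_solution a e z) n = z * jacobi_solution a e z n" for n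
      using a0 e0 by (cases n) (simp_all add: jacobi_def ce field_simps)
    then have "jacobi a e (\<lambda>n. X 0 * jacobi_solution a e z n) n = z * (X 0 * jacobi_solution a e z n)" for n
      by (simp add: jacobi_mult)
    then show ?L using R by metis
  qed
qed

text \<open>Limit-circle behaviour: geometric growth of \<open>a\<close> makes the coefficient of
  the middle term negligible and keeps the other one at most \<open>q < 1\<close>, for every complex
  \<open>z\<close>.\<close>

lemma jacobi_solution_square_summable:
  assumes pos: "\<And>n. 0 < a n" and e: "cmod e = 1" and q: "0 < q" "q < 1"
    and ratio: "\<And>n. a n \<le> q * a (Suc n)"
    and lower: "\<And>n. a 0 \<le> q ^ n * a n"
  shows "summable (\<lambda>n. (cmod (jacobi_solution a e z n))\<^sup>2)"
proof -
  define S where "S n = cmod (jacobi_solution a e z n)" for n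
  \<comment> \<open>Any \<open>r\<close> with \<open>q < r\<^sup>2 < 1\<close> would do: the recurrence then preserves a bound by a multiple of \<open>r ^ n\<close>.\<close>
  define r where "r = sqrt (sqrt q)"
  have r: "0 < r" "r < 1" and rq: "r ^ 4 = q"
    using q power_mult[of r 2 2] by (auto simp: r_def)
  have r2: "r\<^sup>2 < 1" using r by (simp add: power_less_one_iff)
  have "(\<lambda>n. cmod z / a 0 * q ^ Suc n) \<longlonglongrightarrow> cmod z / a 0 * 0"
    by (intro tendsto_mult_left LIMSEQ_Suc LIMSEQ_power_zero) (use q in auto)
  \<comment> \<open>This threshold is chosen so that \<open>r\<close> solves
    \<open>x^2 = r * (1 - r^2) * x + r^4\<close>; a bound by a multiple of \<open>r ^ n\<close> then
    reproduces itself exactly.\<close>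
  moreover have "0 < r * (1 - r\<^sup>2)" using r r2 by simp
  ultimately have "eventually (\<lambda>n. cmod z / a 0 * q ^ Suc n < r * (1 - r\<^sup>2)) sequentially"
    by (auto dest: order_tendstoD)
  then obtain N where N: "\<And>n. N \<le> n \<Longrightarrow> cmod z / a 0 * q ^ Suc n < r * (1 - r\<^sup>2)"
    by (auto simp: eventually_sequentially)
  \<comment> \<open>The lower bound on \<open>a\<close> controls the term with \<open>z\<close>, the
    ratio bound the term with \<open>a n / a (Suc n)\<close>, where
    \<open>q = r ^ 4\<close>.\<close>
  have step: "S (Suc (Suc n)) \<le> r * (1 - r\<^sup>2) * S (Suc n) + r ^ 4 * S n" if "N \<le> n" for n
  proof -
    have "cmod z / a (Suc n) \<le> cmod z / a 0 * q ^ Suc n"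
    proof -
      have "cmod z * a 0 \<le> cmod z * (q ^ Suc n * a (Suc n))"
        using lower[of "Suc n"] by (intro mult_left_mono) auto
      then show ?thesis using pos[of 0] pos[of "Suc n"] by (simp add: field_simps)
    qed
    with N[OF that] have z: "cmod z / a (Suc n) \<le> r * (1 - r\<^sup>2)" by linarith
    have "S (Suc (Suc n)) = cmod (z * jacobi_solution a e z (Suc n) - e * a n * jacobi_solution a e z n) / a (Suc n)"
      using pos[of "Suc n"] by (simp add: S_def norm_mult norm_divide e)
    also have "\<dots> \<le> (cmod z * S (Suc n) + a n * S n) / a (Suc n)"
      using pos[of "Suc n"] pos[of n]
        norm_triangle_ineq4[of "z * jacobi_solution a e z (Suc n)" "e * a n * jacobi_solution a e z n"]
      by (intro divide_right_mono) (auto simp: S_def norm_mult e)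
    also have "\<dots> = cmod z / a (Suc n) * S (Suc n) + a n / a (Suc n) * S n"
      by (simp add: add_divide_distrib)
    also have "\<dots> \<le> r * (1 - r\<^sup>2) * S (Suc n) + r ^ 4 * S n"
      using z ratio[of n] pos[of "Suc n"] unfolding rq
      by (intro add_mono mult_right_mono) (auto simp: S_def field_simps)
    finally show ?thesis .
  qed
  \<comment> \<open>The recurrence has order two, so the constant must cover both starting indices
    \<open>N\<close> and \<open>Suc N\<close>.\<close>
  define M where "M = max (S N / r ^ N) (S (Suc N) / r ^ Suc N)"
  have decay: "S (N + k) \<le> M * r ^ (N + k)" for k
  proof (induction k rule: induct_nat_012)
    case 0
    have "S N / r ^ N \<le> M" by (simp add: M_def)
    then show ?case using r by (simp add: field_simps)
  next
    case 1
    have "S (Suc N) / r ^ Suc N \<le> M" by (simp add: M_def)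
    then show ?case using r by (simp add: field_simps)
  next
    case (ge2 k)
    have "S (N + Suc (Suc k)) \<le> r * (1 - r\<^sup>2) * S (N + Suc k) + r ^ 4 * S (N + k)"
      using step[of "N + k"] by simp
    also have "\<dots> \<le> r * (1 - r\<^sup>2) * (M * r ^ (N + Suc k)) + r ^ 4 * (M * r ^ (N + k))"
      using ge2 r r2 by (intro add_mono mult_left_mono) auto
    also have "\<dots> = M * r ^ (N + Suc (Suc k))"
      by (simp add: algebra_simps power2_eq_square power4_eq_xxxx)
    finally show ?case .
  qed
  have "summable (\<lambda>n. M\<^sup>2 * (r\<^sup>2) ^ n)"
    using r2 by (intro summable_mult summable_geometric) simp
  moreover have "norm ((S n)\<^sup>2) \<le> M\<^sup>2 * (r\<^sup>2) ^ n" if "N \<le> n" for n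
  proof -
    have "(S n)\<^sup>2 \<le> (M * r ^ n)\<^sup>2"
      using decay[of "n - N"] that by (intro power_mono) (auto simp: S_def)
    then show ?thesis by (simp add: power_mult_distrib power_mult[symmetric] mult.commute)
  qed
  ultimately show ?thesis
    unfolding S_def[symmetric] by (rule summable_comparison_test')
qed

section \<open>Deficiency spaces and their dimension\<close>

lemma deficiency_space_I4:
  assumes q: "0 < q" "q < 1" "0 < l"
  shows "\<exists>u. u \<noteq> 0 \<and> deficiency_space q l (I4 q l \<psi>) z = cfps.span {u}"
proof -
  define S where "S = jacobi_solution (I4_entry q l) (exp (\<i> * \<psi>)) z"
  \<comment> \<open>Coordinates are coefficients divided by \<open>cnorm\<close>, so this series has
    coordinates exactly \<open>S n\<close>.\<close>
  define u where "u = Abs_fps (\<lambda>n. S n * cnorm q l n)"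
  have cu: "coord q l u n = S n" for n
    using cnorm_pos[OF q, of n] by (simp add: u_def coord_def)
  have "coord q l u 0 \<noteq> 0" by (simp add: cu S_def)
  then have "u \<noteq> 0" by (auto simp: coord_zero)
  have uh: "u \<in> hspace q l"
    using jacobi_solution_square_summable[of "I4_entry q l" "exp (\<i> * \<psi>)" q z]
      I4_entry_pos[OF q] I4_entry_ratio[OF q] I4_entry_lower_bound[OF q] q
    by (simp add: hspace_def cu S_def)
  have "v \<in> deficiency_space q l (I4 q l \<psi>) z \<longleftrightarrow> v \<in> range (\<lambda>c. cscale c u)" for v
  proof -
    have "v \<in> deficiency_space q l (I4 q l \<psi>) z \<longleftrightarrow>
        v \<in> hspace q l \<and> coord q l v = (\<lambda>n. coord q l v 0 * S n)"
      unfolding deficiency_space_def S_def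
      using jacobi_eigen_iff[of "I4_entry q l" "exp (\<i> * \<psi>)" "coord q l v" z] I4_entry_pos[OF q]
      by (auto simp: op_adjoint_I4[OF q] coord_cscale hspace_cscale eq_commute)
    also have "\<dots> \<longleftrightarrow> v \<in> range (\<lambda>c. cscale c u)"
    proof
      assume v: "v \<in> hspace q l \<and> coord q l v = (\<lambda>n. coord q l v 0 * S n)"
      have "v = cscale (coord q l v 0) u"
        by (rule coord_eqI[OF q]) (use v in \<open>metis coord_cscale cu\<close>)
      then show "v \<in> range (\<lambda>c. cscale c u)" by blast
    next
      assume "v \<in> range (\<lambda>c. cscale c u)"
      then show "v \<in> hspace q l \<and> coord q l v = (\<lambda>n. coord q l v 0 * S n)"
        by (auto simp: hspace_cscale[OF uh] coord_cscale cu S_def)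
    qed
    finally show ?thesis .
  qed
  then have "deficiency_space q l (I4 q l \<psi>) z = cfps.span {u}"
    by (auto simp: cfps.span_singleton)
  with \<open>u \<noteq> 0\<close> show ?thesis by blast
qed

lemma cdim_span_singleton:
  assumes "u \<noteq> 0"
  shows "cdim (cfps.span {u}) = 1"
proof -
  have "cfps.dim (cfps.span {u}) = 1"
    using cfps.dim_span_eq_card_independent[of "{u}"] assms by simp
  moreover have "\<exists>B. finite B \<and> cfps.span B = cfps.span (cfps.span {u})"
    by (intro exI[of _ "{u}"]) (simp add: cfps.span_span)
  ultimately show ?thesis by (simp add: cdim_def one_enat_def)
qed

theorem mainTheorem7:
  fixes q l \<psi> :: real
  assumes "0 < q" and "q < 1" and "0 < l"
  shows "\<not> op_selfadjoint q l (I4 q l \<psi>) \<and>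
         deficiency_indices q l (I4 q l \<psi>) = (1, 1)"
proof
  show "deficiency_indices q l (I4 q l \<psi>) = (1, 1)"
    unfolding deficiency_indices_def
    using deficiency_space_I4[OF assms] cdim_span_singleton by metis
  show "\<not> op_selfadjoint q l (I4 q l \<psi>)"
  proof
    assume "op_selfadjoint q l (I4 q l \<psi>)"
    then have sa: "op_adjoint q l (I4 q l \<psi>) = I4 q l \<psi>" by (simp add: op_selfadjoint_def)
    obtain u where "u \<noteq> 0" and "deficiency_space q l (I4 q l \<psi>) \<i> = cfps.span {u}"
      using deficiency_space_I4[OF assms] by blast
    then have u: "(u, cscale \<i> u) \<in> op_adjoint q l (I4 q l \<psi>)"
      using cfps.span_base[of u "{u}"] by (auto simp: deficiency_space_def)
    then have h: "u \<in> hspace q l" by (simp add: op_adjoint_def)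
    \<comment> \<open>Under selfadjointness the pair lies in the operator and in its adjoint, so it
      can be tested against itself. Linearity in the first and antilinearity in the second argument
      then force the norm of \<open>u\<close> to vanish.\<close>
    have "hinner q l (cscale \<i> u) u = hinner q l u (cscale \<i> u)"
      using u u[unfolded sa] by (auto simp: op_adjoint_def)
    moreover have "hinner q l (cscale \<i> u) u = \<i> * hinner q l u u"
      "hinner q l u (cscale \<i> u) = - \<i> * hinner q l u u"
      using hinner_Cauchy_Schwarz(1)[OF h h]
      by (simp_all add: hinner_def coord_cscale suminf_mult[symmetric] suminf_minus[symmetric] summable_mult mult_ac)
    ultimately have "hinner q l u u = 0" by simp
    then have "hnorm q l u = 0" by (simp add: hnorm_def)
    then have "coord q l u n = coord q l 0 n" for n
      using norm_coord_le_hnorm[OF h, of n] by (simp add: coord_zero)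
    then have "u = 0" by (rule coord_eqI[OF assms])
    with \<open>u \<noteq> 0\<close> show False by simp
  qed
qed

end
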